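(* Let $\mathbf L=(L,\vee,\wedge,{}',0,1)$ be a lattice with complementation. For $x,y\in L$ put $x+_1y:=(x'\wedge y)\vee(x\wedge y')$ and $x+_2y:=(x\vee y)\wedge(x'\vee y')$, and assume that $x+_1y=x+_2y$ for all $x,y\in L$. Let $+$ be either $+_1$ or $+_2$. Then $\mathbf L$ is a Boolean algebra if and only if $(x+y)+y=x$ for all $x,y\in L$.
   Context: A lattice with complementation is an algebra $(L,\vee,\wedge,{}',0,1)$ such that $(L,\vee,\wedge,0,1)$ is a bounded lattice and $'$ is a unary operation on $L$ with $x\vee x'=1$ and $x\wedge x'=0$ for all $x\in L$; the operation $'$ is not assumed to be antitone or an involution. It is a Boolean algebra (Boolean lattice) if its underlying lattice is distributive. *)

theory Defs
  imports "HOL-Library.Complemented_Lattices"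
begin

unbundle lattice_syntax

text \<open>
  A lattice with complementation is a type of class \<^class>\<open>complemented_lattice\<close>: a bounded
  lattice with an operation \<^const>\<open>uminus\<close> satisfying only the two complement laws, neither
  antitone nor an involution. The class also carries \<^const>\<open>minus\<close>, but fixes it to be
  \<open>x \<sqinter> - y\<close>, so it is no additional datum. Bottom and top may coincide.
\<close>

definition plus1 :: "'a::complemented_lattice \<Rightarrow> 'a \<Rightarrow> 'a"  (infixl \<open>+\<^sub>1\<close> 65)
  where "x +\<^sub>1 y = (- x \<sqinter> y) \<squnion> (x \<sqinter> - y)"

definition plus2 :: "'a::complemented_lattice \<Rightarrow> 'a \<Rightarrow> 'a"  (infixl \<open>+\<^sub>2\<close> 65)
  where "x +\<^sub>2 y = (x \<squnion> y) \<sqinter> (- x \<squnion> - y)"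

text \<open>
  For a lattice with complementation, the library's predicate \<open>class.boolean_algebra\<close> says
  exactly that the underlying lattice is distributive.
\<close>

lemma boolean_algebra_iff_distrib_lattice:
  "class.boolean_algebra (-) uminus (\<sqinter>) (\<le>) (<) (\<squnion>) \<bottom> (\<top> :: 'a::complemented_lattice)
   \<longleftrightarrow> class.distrib_lattice (\<sqinter>) (\<le>) (<) ((\<squnion>) :: 'a \<Rightarrow> 'a \<Rightarrow> 'a)"
  unfolding class.boolean_algebra_def class.boolean_algebra_axioms_def
  by (simp add: bounded_lattice_axioms diff_eq)

end

theory Submission
  imports Defs
begin

text \<open>
  In a Boolean algebra \<open>x + y\<close> is the symmetric difference, so adding \<open>y\<close> twice restores \<open>x\<close>.

  For the converse, write \<open>x'\<close> for the complement. Since \<open>x + \<top> = x'\<close>, cancellation makes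
  complementation an involution, whence \<open>x' + y' = x + y\<close>. The sum is also commutative, so each of
  the equations \<open>x + y = z\<close>, \<open>z + y = x\<close>, \<open>x + z = y\<close> implies the others, and complements can be
  pulled out: \<open>(x + y)' = x' + y\<close> (\<open>compl_plus\<close>). Evaluated on comparable elements \<open>x \<le> y\<close>,
  for which \<open>x + y = x' \<sqinter> y\<close>, this is the De Morgan law \<open>(x' \<sqinter> y)' = x \<squnion> y'\<close>, and
  cancellation becomes the orthomodular law \<open>y \<sqinter> (x \<squnion> y') = x\<close>. Together they show
  that complementation is antitone. So the lattice is orthomodular, and one application of the
  equality of the two sums, cut down by \<open>x\<close>, yields \<open>x \<sqinter> (x' \<squnion> y) = x \<sqinter> y\<close>: any two elements
  commute (\<open>inf_compl_sup_le\<close>). Then \<open>x' \<squnion> w\<close> is a relative pseudocomplement of \<open>x\<close> in \<open>w\<close>, so meeting with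
  \<open>x\<close> has a right adjoint and preserves joins (\<open>inf_sup_distrib_of_commuting\<close>).
\<close>

section \<open>Distributivity from relative pseudocomplements\<close>

text \<open>
  By the two hypotheses \<open>x \<sqinter> u \<le> w\<close> is equivalent to \<open>u \<le> - x \<squnion> w\<close>: the first gives the
  direction from right to left and the second the other one. Taking \<open>w\<close> to be
  the join of \<open>x \<sqinter> y\<close> and \<open>x \<sqinter> z\<close> then bounds \<open>y\<close> and \<open>z\<close>, and hence their join, by
  \<open>- x \<squnion> w\<close>.
\<close>

lemma inf_sup_distrib_of_commuting:
  fixes x y z :: "'a::complemented_lattice"
  assumes modus_ponens: "\<And>u v :: 'a. u \<sqinter> (- u \<squnion> v) \<le> v"
    and split: "\<And>u v :: 'a. u \<le> (v \<sqinter> u) \<squnion> - v"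
  shows "x \<sqinter> (y \<squnion> z) = (x \<sqinter> y) \<squnion> (x \<sqinter> z)"
proof (rule order.antisym)
  let ?w = "(x \<sqinter> y) \<squnion> (x \<sqinter> z)"
  have residual: "u \<le> - x \<squnion> ?w" if "x \<sqinter> u \<le> ?w" for u
    using order.trans[OF split[of u x] sup_mono[OF that order_refl[of "- x"]]]
    by (simp only: sup_commute)
  have "y \<squnion> z \<le> - x \<squnion> ?w"
    by (intro sup_least residual) simp_all
  then have "x \<sqinter> (y \<squnion> z) \<le> x \<sqinter> (- x \<squnion> ?w)"
    by (rule inf_mono[OF order_refl])
  also have "\<dots> \<le> ?w" by (rule modus_ponens)
  finally show "x \<sqinter> (y \<squnion> z) \<le> ?w" .
next
  show "(x \<sqinter> y) \<squnion> (x \<sqinter> z) \<le> x \<sqinter> (y \<squnion> z)"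
    by (simp add: le_infI2)
qed

section \<open>Lattices with a cancellative symmetric difference\<close>

locale cancellative_symmetric_difference =
  fixes plus :: "'a::complemented_lattice \<Rightarrow> 'a \<Rightarrow> 'a"  (infixl \<open>\<oplus>\<close> 65)
  assumes plus_eq_plus1: "x \<oplus> y = x +\<^sub>1 y"
    and plus_eq_plus2: "x \<oplus> y = x +\<^sub>2 y"
    and plus_cancel: "(x \<oplus> y) \<oplus> y = x"
begin

lemma plus_eq_sup: "x \<oplus> y = (- x \<sqinter> y) \<squnion> (x \<sqinter> - y)"
  by (simp add: plus_eq_plus1 plus1_def)

lemma plus_eq_inf: "x \<oplus> y = (x \<squnion> y) \<sqinter> (- x \<squnion> - y)"
  by (simp add: plus_eq_plus2 plus2_def)

lemma plus_commute: "x \<oplus> y = y \<oplus> x"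
  by (simp add: plus_eq_inf sup_commute)

lemma compl_compl: "- (- x) = (x :: 'a)"
proof -
  have compl_top: "- \<top> = (\<bottom> :: 'a)"
    by (metis inf_compl_bot inf_top_left)
  have "u \<oplus> \<top> = - u" for u
    by (simp add: plus_eq_sup compl_top)
  then show ?thesis
    using plus_cancel[of x \<top>] by simp
qed

lemma plus_compl_compl: "- x \<oplus> - y = x \<oplus> y"
  by (simp add: plus_eq_sup compl_compl sup_commute)

text \<open>
  Let \<open>z = x \<oplus> y\<close>. Cancelling \<open>x\<close> gives \<open>z \<oplus> x = y\<close>, and both summands may be complemented:
  \<open>- z \<oplus> - x = y\<close>. Cancelling \<open>- x\<close> in this equation isolates \<open>- z\<close>.
\<close>

lemma compl_plus: "- (x \<oplus> y) = - x \<oplus> y"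
proof -
  have "(x \<oplus> y) \<oplus> x = y"
    using plus_cancel[of y x] by (simp add: plus_commute)
  then have "- (x \<oplus> y) \<oplus> - x = y"
    by (simp add: plus_compl_compl)
  then have "y \<oplus> - x = - (x \<oplus> y)"
    using plus_cancel by metis
  then show ?thesis
    by (simp add: plus_commute)
qed

lemma plus_of_le:
  fixes x y :: 'a
  assumes "x \<le> y"
  shows "x \<oplus> y = - x \<sqinter> y"
proof -
  have "x \<sqinter> - y \<le> y \<sqinter> - y"
    using assms by (rule inf_mono) simp
  then have "x \<sqinter> - y = \<bottom>"
    by (simp add: bot_unique)
  then show ?thesis
    by (simp add: plus_eq_sup)
qed

lemma compl_inf_of_le:
  fixes x y :: 'a
  assumes "x \<le> y"
  shows "- (- x \<sqinter> y) = x \<squnion> - y"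
proof -
  have "- x \<squnion> x \<le> - x \<squnion> y"
    using sup_mono[OF order_refl assms] .
  then have "- x \<squnion> y = \<top>"
    by (simp add: top_unique)
  moreover have "- (- x \<sqinter> y) = (- x \<squnion> y) \<sqinter> (x \<squnion> - y)"
    using compl_plus[of x y] plus_of_le[OF assms]
    by (simp add: plus_eq_inf compl_compl)
  ultimately show ?thesis
    by simp
qed

lemma orthomodular:
  fixes x y :: 'a
  assumes "x \<le> y"
  shows "y \<sqinter> (x \<squnion> - y) = x"
proof -
  have "(- x \<sqinter> y) \<oplus> y = x"
    using plus_cancel[of x y] plus_of_le[OF assms] by simp
  then show ?thesis
    using plus_of_le[of "- x \<sqinter> y" y] compl_inf_of_le[OF assms]
    by (simp add: inf_commute)
qed

text \<open>
  For \<open>x \<le> y\<close>, the De Morgan law applied to the relative complement \<open>- x \<sqinter> y\<close> of \<open>x\<close> in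
  \<open>y\<close> exhibits \<open>- x\<close> as a join with \<open>- y\<close>.
\<close>

lemma compl_antitone:
  fixes x y :: 'a
  assumes "x \<le> y"
  shows "- y \<le> - x"
proof -
  have "- (- (- x \<sqinter> y) \<sqinter> y) = (- x \<sqinter> y) \<squnion> - y"
    by (rule compl_inf_of_le) simp
  moreover have "- (- x \<sqinter> y) \<sqinter> y = x"
    using compl_inf_of_le[OF assms] orthomodular[OF assms]
    by (simp add: inf_commute)
  ultimately show ?thesis
    by (metis sup_ge2)
qed

lemma compl_sup: "- (x \<squnion> y) = - x \<sqinter> - (y :: 'a)"
proof (rule order.antisym)
  show "- (x \<squnion> y) \<le> - x \<sqinter> - y"
    by (simp add: compl_antitone)
  have "x \<squnion> y \<le> - (- x \<sqinter> - y)"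
    using compl_antitone[of "- x \<sqinter> - y" "- x"] compl_antitone[of "- x \<sqinter> - y" "- y"]
    by (simp add: compl_compl)
  then show "- x \<sqinter> - y \<le> - (x \<squnion> y)"
    using compl_antitone compl_compl by metis
qed

lemma compl_inf: "- (x \<sqinter> y) = - x \<squnion> - (y :: 'a)"
  using compl_sup[of "- x" "- y"] by (metis compl_compl)

text \<open>
  In the sum of \<open>x\<close> and \<open>- y\<close>, the meet form lies above \<open>x \<sqinter> (- x \<squnion> y)\<close>, whereas the summand
  \<open>- x \<sqinter> - y\<close> of the join form lies below \<open>- x\<close> and is therefore absorbed, by orthomodularity,
  on meeting with \<open>x\<close>. Only \<open>x \<sqinter> y\<close> is left.
\<close>

lemma inf_compl_sup_le: "x \<sqinter> (- x \<squnion> y) \<le> (y :: 'a)"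
proof -
  have "x \<sqinter> (- x \<squnion> y) \<le> x \<oplus> - y"
    by (simp add: plus_eq_inf compl_compl le_infI1)
  then have "x \<sqinter> (- x \<squnion> y) \<le> x \<sqinter> ((- x \<sqinter> - y) \<squnion> (x \<sqinter> y))"
    by (simp add: plus_eq_sup compl_compl)
  also have "\<dots> \<le> x \<sqinter> ((x \<sqinter> y) \<squnion> - x)"
    by (intro inf_mono sup_least) (simp_all add: le_supI2)
  also have "\<dots> = x \<sqinter> y"
    by (rule orthomodular) simp
  finally show ?thesis
    by simp
qed

text \<open>This is the previous inequality, for \<open>y\<close> and \<open>- x\<close>, dualized by complementation.\<close>

lemma le_inf_sup_compl: "x \<le> (y \<sqinter> x) \<squnion> - (y :: 'a)"
proof -
  have "- y \<le> - (y \<sqinter> (- y \<squnion> - x))"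
    by (rule compl_antitone) simp
  moreover have "- (- x) \<le> - (y \<sqinter> (- y \<squnion> - x))"
    by (rule compl_antitone[OF inf_compl_sup_le])
  ultimately show ?thesis
    by (simp add: compl_inf compl_sup compl_compl sup_commute inf_commute)
qed

lemma distrib_lattice:
  "class.distrib_lattice (\<sqinter>) (\<le>) (<) ((\<squnion>) :: 'a \<Rightarrow> 'a \<Rightarrow> 'a)"
  by unfold_locales
    (rule distrib_imp1, rule inf_sup_distrib_of_commuting[OF inf_compl_sup_le le_inf_sup_compl])

end

section \<open>Cancellation in Boolean algebras\<close>

text \<open>
  With \<open>z = x +\<^sub>1 y\<close>, the two parts of \<open>z +\<^sub>1 y\<close> are \<open>- z \<sqinter> y = x \<sqinter> y\<close> and
  \<open>z \<sqinter> - y = x \<sqinter> - y\<close>, and these make up \<open>x\<close>.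
\<close>

lemma plus1_cancel_of_boolean_algebra:
  fixes x y :: "'a::complemented_lattice"
  assumes "class.boolean_algebra (-) uminus (\<sqinter>) (\<le>) (<) (\<squnion>) \<bottom> (\<top> :: 'a)"
  shows "(x +\<^sub>1 y) +\<^sub>1 y = x"
proof -
  interpret B: boolean_algebra "(-)" uminus "(\<sqinter>)" "(\<le>)" "(<)" "(\<squnion>)" "\<bottom>" "\<top> :: 'a"
    by (rule assms)
  have outside: "(x +\<^sub>1 y) \<sqinter> - y = x \<sqinter> - y"
    by (simp add: plus1_def B.inf_sup_distrib2 inf_assoc)
  have "- (x +\<^sub>1 y) = (x \<squnion> - y) \<sqinter> (- x \<squnion> y)"
    by (simp add: plus1_def)
  moreover have "(- x \<squnion> y) \<sqinter> y = y"
    by (simp add: inf_absorb2)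
  ultimately have "- (x +\<^sub>1 y) \<sqinter> y = (x \<squnion> - y) \<sqinter> y"
    by (simp only: inf_assoc)
  then have inside: "- (x +\<^sub>1 y) \<sqinter> y = x \<sqinter> y"
    by (simp add: B.inf_sup_distrib2)
  have "(x +\<^sub>1 y) +\<^sub>1 y = (x \<sqinter> y) \<squnion> (x \<sqinter> - y)"
    by (subst plus1_def) (simp only: inside outside)
  also have "\<dots> = x"
    by (simp flip: B.inf_sup_distrib1)
  finally show ?thesis .
qed

theorem theorem3p4:
  fixes plus :: "'a::complemented_lattice \<Rightarrow> 'a \<Rightarrow> 'a"
  assumes "\<forall>x y :: 'a. x +\<^sub>1 y = x +\<^sub>2 y"
    and "plus = (+\<^sub>1) \<or> plus = (+\<^sub>2)"
  shows "class.boolean_algebra (-) uminus (\<sqinter>) (\<le>) (<) (\<squnion>) \<bottom> (\<top> :: 'a)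
    \<longleftrightarrow> (\<forall>x y. plus (plus x y) y = x)"
proof -
  have sums: "plus x y = x +\<^sub>1 y" "plus x y = x +\<^sub>2 y" for x y
    using assms by auto
  show ?thesis
  proof
    assume "class.boolean_algebra (-) uminus (\<sqinter>) (\<le>) (<) (\<squnion>) \<bottom> (\<top> :: 'a)"
    then show "\<forall>x y. plus (plus x y) y = x"
      unfolding sums(1) by (blast intro: plus1_cancel_of_boolean_algebra)
  next
    assume "\<forall>x y. plus (plus x y) y = x"
    then interpret cancellative_symmetric_difference plus
      using sums by unfold_locales auto
    show "class.boolean_algebra (-) uminus (\<sqinter>) (\<le>) (<) (\<squnion>) \<bottom> (\<top> :: 'a)"
      unfolding boolean_algebra_iff_distrib_lattice by (rule distrib_lattice)
  qed
qed

end
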